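(* Let $\rho$ be the unique real number $s>1$ with $\zeta(s)=2$, and let $c$ be the positive constant such that $A(x)\sim c\,x^{\rho}$ as $x\to\infty$, where $A(x)=\sum_{n\le x}a(n)$. Then for every positive integer $k$, \[ -\frac{2}{\rho\,\zeta'(\rho)}\sum_{d_1,d_2,\ldots,d_k>1}\frac{1}{\bigl(2+d_1+d_1d_2+\cdots+(d_1d_2\cdots d_k)\bigr)^{\rho}}\;\le\; c\;\le\;-\frac{2}{\rho\,\zeta'(\rho)}\sum_{d_1,d_2,\ldots,d_k>1}\frac{1}{\bigl(1+d_1+d_1d_2+\cdots+(d_1d_2\cdots d_k)\bigr)^{\rho}}, \] where both sums run over all $k$-tuples $(d_1,\ldots,d_k)$ of integers greater than $1$.
   Context: For a positive integer $n$, $a(n)$ denotes the number of partitions of $n$ of the form $n=a_1+a_2+\cdots+a_k$ (with $k\ge 1$ arbitrary and the $a_i$ positive integers) in which $a_{i+1}$ is a proper divisor of $a_i$ for all $i<k$; equivalently, partitions into distinct parts in which every part is a multiple of the next part. For real $x$, $A(x)=\sum_{n\le x}a(n)$, the sum being over positive integers $n\le x$. $\zeta$ is the Riemann zeta function and $\zeta'$ its derivative; $\rho\approx 1.73$, and $\zeta'(\rho)<0$. It is a known theorem of Erdős and Loxton that there exists a positive constant $c$ with $A(x)\sim c\,x^{\rho}$ as $x\to\infty$; this is the constant $c$ in the claim. *)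

theory Defs
  imports "HOL-Analysis.Analysis" "HOL-Library.Landau_Symbols"
begin

text \<open>
  A partition is represented by the list of its parts in decreasing order; along such a
  list each part is a proper divisor of its predecessor.
\<close>

definition chain_partitions :: "nat \<Rightarrow> nat list set" where
  "chain_partitions n =
     {xs. xs \<noteq> [] \<and> (\<forall>x\<in>set xs. 0 < x) \<and>
          successively (\<lambda>x y. y dvd x \<and> y \<noteq> x) xs \<and> sum_list xs = n}"

definition chain_partition_count :: "nat \<Rightarrow> nat" where
  "chain_partition_count n = card (chain_partitions n)"

definition chain_partition_sum :: "real \<Rightarrow> real" where
  "chain_partition_sum x = (\<Sum>n | 1 \<le> n \<and> real n \<le> x. real (chain_partition_count n))"

text \<open>
  The Riemann zeta function on the real half-line \<open>s > 1\<close>, the only region where its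
  values and its derivative are used; the series diverges for \<open>s \<le> 1\<close>.
\<close>

definition zeta :: "real \<Rightarrow> real" where
  "zeta s = (\<Sum>n. 1 / real (Suc n) powr s)"

definition divisor_tuples :: "nat \<Rightarrow> (nat \<Rightarrow> nat) set" where
  "divisor_tuples k = {1..k} \<rightarrow>\<^sub>E {1<..}"

definition product_sum :: "nat \<Rightarrow> (nat \<Rightarrow> nat) \<Rightarrow> nat" where
  "product_sum k d = (\<Sum>j=1..k. \<Prod>i=1..j. d i)"

end

theory Submission imports Defs begin

text \<open>
  A chain partition is determined by its smallest part \<open>m\<close> and by the successive quotients
  \<open>d\<^sub>1, d\<^sub>2, \<dots>, d\<^sub>k > 1\<close> of its parts, read upwards; its sum is
  \<open>m (1 + d\<^sub>1 + d\<^sub>1 d\<^sub>2 + \<dots> + d\<^sub>1 \<dots> d\<^sub>k)\<close>. Hence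
  \<open>\<Sum>n. a(n) / n\<^sup>s = \<zeta>(s) (F\<^sub>0(s) + F\<^sub>1(s) + \<dots>)\<close>, where
  \<open>F\<^sub>k(s) = \<Sum> 1 / (1 + d\<^sub>1 + \<dots> + d\<^sub>1 \<dots> d\<^sub>k)\<^sup>s\<close> is the upper sum of the theorem with
  \<open>\<rho>\<close> replaced by \<open>s\<close>. Let \<open>G\<^sub>k(s)\<close> be the corresponding lower sum, with \<open>2\<close> in place of \<open>1\<close>.

  A tuple of length \<open>k + 1\<close> is a first quotient \<open>d\<close> followed by a tuple of length \<open>k\<close>, and if the
  latter has nested sum \<open>N = d\<^sub>1 + d\<^sub>1 d\<^sub>2 + \<dots>\<close>, the former has nested sum \<open>d (1 + N)\<close>. As
  \<open>1 + d (1 + N) \<ge> d (1 + N)\<close> while \<open>2 + d (1 + N) \<le> d (2 + N)\<close>, summation over \<open>d\<close> gives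
  \<open>F\<^sub>k\<^sub>+\<^sub>1 \<le> (\<zeta> - 1) F\<^sub>k\<close> and \<open>G\<^sub>k\<^sub>+\<^sub>1 \<ge> (\<zeta> - 1) G\<^sub>k\<close>. For \<open>s > \<rho>\<close> near \<open>\<rho>\<close>, where \<open>\<zeta>(s) < 2\<close>, comparison
  of the tail of \<open>\<Sum>j. F\<^sub>j(s)\<close> with geometric series yields
  \<open>G\<^sub>k(s) \<le> (2 - \<zeta>(s)) (\<Sum>j. F\<^sub>j(s)) \<le> (2 - \<zeta>(s)) (\<Sum>j<k. F\<^sub>j(s)) + F\<^sub>k(s)\<close>
  (lemmas \<open>layers_lower\<close> and \<open>layers_upper\<close>).

  It remains to let \<open>s\<close> decrease to \<open>\<rho>\<close>. An Abelian argument (\<open>dirichlet_series_pole\<close>) turns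
  \<open>A(x) \<sim> c x\<^sup>\<rho>\<close> into \<open>(s - \<rho>) (\<Sum>n. a(n) / n\<^sup>s) \<longlongrightarrow> \<rho> c\<close>, while \<open>\<zeta>(s) \<longlongrightarrow> 2\<close> and
  \<open>(2 - \<zeta>(s)) / (s - \<rho>) \<longlongrightarrow> - \<zeta>'(\<rho>)\<close>. So the middle term tends to \<open>- \<zeta>'(\<rho>) \<rho> c / 2\<close>
  (\<open>layers_limit\<close>), and the outer terms pass to \<open>G\<^sub>k(\<rho>)\<close> and \<open>F\<^sub>k(\<rho>)\<close>.
\<close>

section \<open>The zeta series\<close>

lemma zeta_summable:
  assumes "s > 1"
  shows "summable (\<lambda>n. real (Suc n) powr -s)"
  using assms by (subst summable_Suc_iff) (simp add: summable_real_powr_iff)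

lemma zeta_eq: "zeta s = (\<Sum>n. real (Suc n) powr -s)"
  unfolding zeta_def by (simp add: powr_minus_divide)

lemma zeta_has_sum:
  assumes "s > 1"
  shows "((\<lambda>n. real n powr -s) has_sum zeta s) {0<..}"
proof -
  have "((\<lambda>n. real (Suc n) powr -s) has_sum zeta s) UNIV"
    unfolding zeta_eq
    by (rule sums_nonneg_imp_has_sum) (use zeta_summable[OF assms] in \<open>auto simp: summable_sums\<close>)
  moreover have "bij_betw Suc UNIV {0<..}"
    by (rule bij_betwI[where g = "\<lambda>n. n - 1"]) auto
  ultimately show ?thesis
    using has_sum_reindex_bij_betw[of Suc UNIV "{0<..}" "\<lambda>n. real n powr -s" "zeta s"] by simp
qed

lemma zeta_minus_1_has_sum:
  assumes "s > 1"
  shows "((\<lambda>n. real n powr -s) has_sum (zeta s - 1)) {1<..}"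
proof -
  have summable: "(\<lambda>n. real n powr -s) summable_on {1<..}"
    by (rule summable_on_subset[OF has_sum_imp_summable[OF zeta_has_sum[OF assms]]]) auto
  then have "((\<lambda>n. real n powr -s) has_sum (real 1 powr -s + infsum (\<lambda>n. real n powr -s) {1<..}))
               (insert 1 {1<..})"
    by (intro has_sum_insert) (auto simp: add.commute)
  moreover have "insert 1 {1<..} = {0::nat<..}" by auto
  ultimately have "zeta s = 1 + infsum (\<lambda>n. real n powr -s) {1<..}"
    using zeta_has_sum[OF assms] has_sum_unique by fastforce
  with summable show ?thesis by (simp add: has_sum_iff)
qed

lemma zeta_ge_1: "s > 1 \<Longrightarrow> zeta s \<ge> 1"
  using has_sum_nonneg[OF zeta_minus_1_has_sum] by fastforce

text \<open>
  The series is differentiated termwise on a half-line \<open>{\<sigma><..}\<close> with \<open>1 < \<sigma> < r\<close>, where the series of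
  derivatives converges uniformly; each of its terms beyond the first is negative.
\<close>

lemma zeta_has_negative_derivative:
  assumes "r > 1"
  obtains D where "(zeta has_real_derivative D) (at r)" "D < 0"
proof -
  define \<sigma> where "\<sigma> = (1 + r) / 2"
  have \<sigma>: "1 < \<sigma>" "\<sigma> < r" using assms by (auto simp: \<sigma>_def)
  \<comment> \<open>The logarithm is absorbed by a power \<open>a\<close> so small that \<open>\<sigma> - a\<close> still exceeds 1.\<close>
  define a where "a = (\<sigma> - 1) / 2"
  have a: "a > 0" "a - \<sigma> < -1" using \<sigma> by (auto simp: a_def field_simps)
  define f' where "f' n x = - ln (real (Suc n)) * real (Suc n) powr -x" for n x
  have "summable (\<lambda>n. real (Suc n) powr (a - \<sigma>) / a)"
    using a by (intro summable_divide) (subst summable_Suc_iff, simp add: summable_real_powr_iff)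
  moreover have f'_bound: "norm (f' n x) \<le> real (Suc n) powr (a - \<sigma>) / a" if "x \<ge> \<sigma>" for n x
  proof -
    have "norm (f' n x) = ln (real (Suc n)) * real (Suc n) powr -x"
      by (simp add: f'_def abs_mult)
    also have "\<dots> \<le> (real (Suc n) powr a / a) * real (Suc n) powr -\<sigma>"
      using that a by (intro mult_mono ln_powr_bound powr_mono) auto
    also have "\<dots> = real (Suc n) powr (a - \<sigma>) / a"
      by (simp add: powr_diff powr_minus_divide)
    finally show ?thesis .
  qed
  ultimately have unif: "uniformly_convergent_on {\<sigma><..} (\<lambda>n x. \<Sum>i<n. f' i x)"
    by (intro Weierstrass_m_test'[where M = "\<lambda>n. real (Suc n) powr (a - \<sigma>) / a"]) auto
  have deriv: "((\<lambda>x. real (Suc n) powr -x) has_real_derivative f' n x) (at x within A)" for n x A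
    unfolding powr_def f'_def
    by (auto intro!: derivative_eq_intros simp del: of_nat_Suc)
  have "((\<lambda>x. \<Sum>n. real (Suc n) powr -x) has_real_derivative (\<Sum>n. f' n r)) (at r)"
    by (rule has_field_derivative_series'(2)[OF _ deriv unif, of r])
       (use \<sigma> zeta_summable[of r] assms in \<open>auto simp: interior_open simp del: of_nat_Suc\<close>)
  then have "(zeta has_real_derivative (\<Sum>n. f' n r)) (at r)"
    by (simp add: zeta_eq[abs_def])
  moreover have summable: "summable (\<lambda>n. f' n r)"
    by (rule summable_comparison_test'[OF \<open>summable (\<lambda>n. real (Suc n) powr (a - \<sigma>) / a)\<close>, of 0])
       (rule f'_bound, use \<sigma> in simp)
  have "(\<Sum>n. - f' n r) > 0"
    by (rule suminf_pos2[OF summable_minus[OF summable], of 1]) (simp_all add: f'_def)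
  then have "(\<Sum>n. f' n r) < 0"
    by (simp add: suminf_minus[OF summable])
  ultimately show ?thesis using that by blast
qed

section \<open>Sums over chains of fixed length\<close>

lemma has_sum_times_nonneg:
  fixes f :: "'a \<Rightarrow> real" and g :: "'b \<Rightarrow> real"
  assumes f: "(f has_sum a) A" and g: "(g has_sum b) B"
    and nonneg: "\<And>x. x \<in> A \<Longrightarrow> f x \<ge> 0" "\<And>y. y \<in> B \<Longrightarrow> g y \<ge> 0"
  shows "((\<lambda>(x, y). f x * g y) has_sum a * b) (A \<times> B)"
proof (rule has_sum_SigmaI)
  show inner: "((\<lambda>y. case (x, y) of (x, y) \<Rightarrow> f x * g y) has_sum f x * b) B" if "x \<in> A" for x
    using has_sum_cmult_right[OF g, of "f x"] by simp
  show outer: "((\<lambda>x. f x * b) has_sum a * b) A"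
    using has_sum_cmult_left[OF f] .
  show "(\<lambda>(x, y). f x * g y) summable_on A \<times> B"
    by (rule summable_on_SigmaI[OF inner has_sum_imp_summable[OF outer]]) (auto simp: nonneg)
qed

lemma powr_minus_antimono_nat:
  assumes "s \<ge> 0" "0 < m" "m \<le> n"
  shows "real n powr -s \<le> real m powr -s"
  using assms by (intro powr_mono2') auto

text \<open>
  The form \<open>d\<^sub>1 (1 + d\<^sub>2 (1 + \<dots>))\<close> of the sum \<open>d\<^sub>1 + d\<^sub>1 d\<^sub>2 + \<dots>\<close> exposes the first quotient, on which
  all recursions below are based.
\<close>

fun nested_sum :: "nat list \<Rightarrow> nat" where
  "nested_sum [] = 0"
| "nested_sum (d # ds) = d * (1 + nested_sum ds)"

definition ratio_lists :: "nat \<Rightarrow> nat list set" where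
  "ratio_lists k = {ds. set ds \<subseteq> {1<..} \<and> length ds = k}"

text \<open>
  With the quotients \<open>ds\<close> as above, \<open>layer 1\<close> is the Dirichlet series of the chains with \<open>k + 1\<close> parts
  and smallest part 1 (the \<open>F\<^sub>k\<close> of the introduction); \<open>layer 2\<close> is the shifted series \<open>G\<^sub>k\<close>.
\<close>

definition layer :: "nat \<Rightarrow> real \<Rightarrow> nat \<Rightarrow> real" where
  "layer t s k = (\<Sum>\<^sub>\<infinity>ds\<in>ratio_lists k. real (t + nested_sum ds) powr -s)"

lemma ratio_lists_0: "ratio_lists 0 = {[]}"
  by (auto simp: ratio_lists_def)

lemma bij_betw_ratio_lists_Suc:
  "bij_betw (\<lambda>(d, ds). d # ds) ({1<..} \<times> ratio_lists k) (ratio_lists (Suc k))"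
  by (rule bij_betwI[where g = "\<lambda>ds. (hd ds, tl ds)"])
     (auto simp: ratio_lists_def length_Suc_conv)

text \<open>
  Multiplying the shifted nested sum by a new quotient \<open>d\<close> gives a term that factorizes exactly. It is
  the quantity with which the next layer is compared.
\<close>

lemma layer_shifted_product:
  assumes "s > 1" "(\<lambda>ds. real (t + nested_sum ds) powr -s) summable_on ratio_lists k"
  shows "((\<lambda>(d, ds). real (d * (t + nested_sum ds)) powr -s)
           has_sum (zeta s - 1) * layer t s k) ({1<..} \<times> ratio_lists k)"
  using has_sum_times_nonneg[OF zeta_minus_1_has_sum[OF assms(1)] has_sum_infsum[OF assms(2)]]
  by (simp add: layer_def powr_mult del: of_nat_add)

text \<open>
  The case \<open>t = 1\<close> goes by induction on \<open>k\<close>: a term of the next layer is smaller than the corresponding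
  term of the product series. Larger \<open>t\<close> only decrease the terms.
\<close>

lemma layer_summable:
  assumes "s > 1" "t > 0"
  shows "(\<lambda>ds. real (t + nested_sum ds) powr -s) summable_on ratio_lists k"
proof -
  have one: "(\<lambda>ds. real (1 + nested_sum ds) powr -s) summable_on ratio_lists k"
  proof (induction k)
    case 0
    then show ?case by (simp add: ratio_lists_0)
  next
    case (Suc k)
    have "(\<lambda>x. real (1 + nested_sum (case x of (d, ds) \<Rightarrow> d # ds)) powr -s)
            summable_on {1<..} \<times> ratio_lists k"
      by (rule summable_on_comparison_test[OF has_sum_imp_summable[OF layer_shifted_product[OF assms(1) Suc]]])
         (use assms(1) in \<open>auto intro!: powr_minus_antimono_nat simp del: of_nat_add of_nat_mult of_nat_Suc\<close>)
    then show ?case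
      by (subst (asm) summable_on_reindex_bij_betw[OF bij_betw_ratio_lists_Suc])
  qed
  show ?thesis
    by (rule summable_on_comparison_test[OF one])
       (use assms in \<open>auto intro!: powr_mono2'\<close>)
qed

lemma layer_Suc_has_sum:
  assumes "s > 1" "t > 0"
  shows "((\<lambda>(d, ds). real (t + d * (1 + nested_sum ds)) powr -s)
           has_sum layer t s (Suc k)) ({1<..} \<times> ratio_lists k)"
proof -
  have "((\<lambda>x. real (t + nested_sum (case x of (d, ds) \<Rightarrow> d # ds)) powr -s)
           has_sum layer t s (Suc k)) ({1<..} \<times> ratio_lists k)"
    unfolding layer_def
    by (subst has_sum_reindex_bij_betw[OF bij_betw_ratio_lists_Suc])
       (rule has_sum_infsum[OF layer_summable[OF assms]])
  then show ?thesis by (simp add: case_prod_unfold)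
qed

text \<open>
  Because \<open>1 + d (1 + N) \<ge> d (1 + N)\<close>.
\<close>

lemma layer_1_Suc_le:
  assumes "s > 1"
  shows "layer 1 s (Suc k) \<le> (zeta s - 1) * layer 1 s k"
  by (rule has_sum_mono[OF layer_Suc_has_sum layer_shifted_product])
     (use assms layer_summable[of s 1 k] in
      \<open>auto intro!: powr_minus_antimono_nat simp del: of_nat_add of_nat_mult of_nat_Suc\<close>)

text \<open>
  Because \<open>2 + d (1 + N) \<le> d (2 + N)\<close>, which is where \<open>d \<ge> 2\<close> enters.
\<close>

lemma layer_2_Suc_ge:
  assumes "s > 1"
  shows "(zeta s - 1) * layer 2 s k \<le> layer 2 s (Suc k)"
  by (rule has_sum_mono[OF layer_shifted_product layer_Suc_has_sum])
     (use assms layer_summable[of s 2 k] in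
      \<open>auto intro!: powr_minus_antimono_nat simp del: of_nat_add of_nat_mult of_nat_Suc\<close>)

lemma layer_nonneg: "layer t s k \<ge> 0"
  unfolding layer_def by (rule infsum_nonneg) auto

lemma layer_2_le_1: "s > 1 \<Longrightarrow> layer 2 s k \<le> layer 1 s k"
  unfolding layer_def by (intro infsum_mono layer_summable) (auto intro!: powr_mono2')

lemma layer_1_antimono:
  assumes "1 < s" "s \<le> s'"
  shows "layer 1 s' k \<le> layer 1 s k"
  unfolding layer_def by (intro infsum_mono layer_summable) (use assms in \<open>auto intro!: powr_mono\<close>)

lemma layer_1_geometric:
  assumes "s > 1"
  shows "layer 1 s (j + k) \<le> (zeta s - 1) ^ j * layer 1 s k"
proof (induction j)
  case (Suc j)
  have "layer 1 s (Suc (j + k)) \<le> (zeta s - 1) * layer 1 s (j + k)"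
    by (rule layer_1_Suc_le[OF assms])
  also have "\<dots> \<le> (zeta s - 1) * ((zeta s - 1) ^ j * layer 1 s k)"
    using Suc zeta_ge_1[OF assms] by (intro mult_left_mono) auto
  finally show ?case by (simp add: mult.assoc)
qed simp

lemma layer_2_geometric:
  assumes "s > 1"
  shows "(zeta s - 1) ^ j * layer 2 s k \<le> layer 2 s (j + k)"
proof (induction j)
  case (Suc j)
  have "(zeta s - 1) * ((zeta s - 1) ^ j * layer 2 s k) \<le> (zeta s - 1) * layer 2 s (j + k)"
    using Suc zeta_ge_1[OF assms] by (intro mult_left_mono) auto
  also have "\<dots> \<le> layer 2 s (Suc (j + k))"
    by (rule layer_2_Suc_ge[OF assms])
  finally show ?case by (simp add: mult.assoc)
qed simp

text \<open>
  The layers from index \<open>k\<close> on lie below a geometric series started at \<open>layer 1 s k\<close>, and above one started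
  at \<open>layer 2 s k\<close>. The common ratio \<open>\<zeta>(s) - 1\<close> makes both sums a multiple of \<open>1 / (2 - \<zeta>(s))\<close>.
\<close>

lemma
  assumes "s > 1" "zeta s < 2"
  shows layers_summable: "summable (\<lambda>k. layer 1 s k)"
    and layers_upper: "(2 - zeta s) * (\<Sum>j. layer 1 s j) \<le> (2 - zeta s) * (\<Sum>j<k. layer 1 s j) + layer 1 s k"
    and layers_lower: "layer 2 s k \<le> (2 - zeta s) * (\<Sum>j. layer 1 s j)"
proof -
  define q where "q = zeta s - 1"
  have q: "0 \<le> q" "q < 1" and two: "2 - zeta s = 1 - q"
    using assms zeta_ge_1[of s] by (auto simp: q_def)
  have geometric: "(\<lambda>j. q ^ j * x) sums (x / (1 - q))" for x
    using sums_mult2[OF geometric_sums[of q], of x] q by simp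
  show summable: "summable (\<lambda>k. layer 1 s k)"
    by (rule summable_comparison_test'[OF sums_summable[OF geometric[of "layer 1 s 0"]]])
       (use layer_1_geometric[OF assms(1), of _ 0] in \<open>simp add: q_def layer_nonneg\<close>)
  define R where "R = (\<Sum>j. layer 1 s (j + k))"
  have split: "(\<Sum>j. layer 1 s j) = R + (\<Sum>j<k. layer 1 s j)"
    unfolding R_def by (rule suminf_split_initial_segment[OF summable])
  have tail: "summable (\<lambda>j. layer 1 s (j + k))"
    using summable by (rule summable_ignore_initial_segment)
  have "R \<le> layer 1 s k / (1 - q)"
    unfolding R_def using layer_1_geometric[OF assms(1), of _ k]
    by (intro sums_le[OF _ summable_sums[OF tail] geometric]) (auto simp: q_def)
  then show "(2 - zeta s) * (\<Sum>j. layer 1 s j) \<le> (2 - zeta s) * (\<Sum>j<k. layer 1 s j) + layer 1 s k"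
    unfolding split two using q by (simp add: field_simps)
  have "layer 2 s k / (1 - q) \<le> R"
    unfolding R_def
    by (intro sums_le[OF _ geometric summable_sums[OF tail]])
       (use order_trans[OF layer_2_geometric layer_2_le_1] assms(1) in \<open>simp add: q_def\<close>)
  also have "R \<le> (\<Sum>j. layer 1 s j)"
    unfolding split by (simp add: sum_nonneg layer_nonneg)
  finally show "layer 2 s k \<le> (2 - zeta s) * (\<Sum>j. layer 1 s j)"
    unfolding two using q by (simp add: field_simps)
qed

lemma layers_has_sum:
  assumes "s > 1" "zeta s < 2"
  shows "((\<lambda>ds. real (1 + nested_sum ds) powr -s) has_sum (\<Sum>k. layer 1 s k)) (lists {1<..})"
proof -
  have inner: "((\<lambda>ds. case (k, ds) of (k, ds) \<Rightarrow> real (1 + nested_sum ds) powr -s) has_sum layer 1 s k)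
      (ratio_lists k)" for k
    using layer_summable[OF assms(1), of 1 k] by (simp add: layer_def)
  have outer: "((\<lambda>k. layer 1 s k) has_sum (\<Sum>k. layer 1 s k)) UNIV"
    by (rule sums_nonneg_imp_has_sum) (use layers_summable[OF assms] in \<open>auto simp: layer_nonneg summable_sums\<close>)
  have "((\<lambda>(k, ds). real (1 + nested_sum ds) powr -s) has_sum (\<Sum>k. layer 1 s k)) (Sigma UNIV ratio_lists)"
    by (rule has_sum_SigmaI[OF inner outer summable_on_SigmaI[OF inner has_sum_imp_summable[OF outer]]]) auto
  moreover have "bij_betw snd (Sigma UNIV ratio_lists) (lists {1<..})"
    by (rule bij_betwI[where g = "\<lambda>ds. (length ds, ds)"]) (auto simp: ratio_lists_def)
  ultimately show ?thesis
    using has_sum_reindex_bij_betw[of snd "Sigma UNIV ratio_lists" "lists {1<..}"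
            "\<lambda>ds. real (1 + nested_sum ds) powr -s"] by (simp add: case_prod_unfold)
qed

lemma nested_sum_snoc: "nested_sum (ds @ [d]) = nested_sum ds + prod_list ds * d"
  by (induction ds) (auto simp: algebra_simps)

lemma product_sum_eq_nested_sum: "product_sum k d = nested_sum (map d [1..<Suc k])"
proof (induction k)
  case (Suc k)
  have "prod_list (map d [1..<Suc k]) = (\<Prod>i=1..k. d i)"
    by (subst prod.distinct_set_conv_list[symmetric]) (auto simp: atLeastLessThanSuc_atLeastAtMost simp del: upt_Suc)
  with Suc show ?case
    by (simp add: product_sum_def nested_sum_snoc del: upt_Suc) (simp add: nested_sum_snoc)
qed (simp add: product_sum_def)

lemma bij_betw_divisor_tuples:
  "bij_betw (\<lambda>d. map d [1..<Suc k]) (divisor_tuples k) (ratio_lists k)"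
proof (rule bij_betwI[where g = "\<lambda>ds. \<lambda>i\<in>{1..k}. ds ! (i - 1)"])
  show "(\<lambda>d. map d [1..<Suc k]) \<in> divisor_tuples k \<rightarrow> ratio_lists k"
    by (auto simp: divisor_tuples_def ratio_lists_def PiE_iff simp del: upt_Suc)
  show "(\<lambda>ds. \<lambda>i\<in>{1..k}. ds ! (i - 1)) \<in> ratio_lists k \<rightarrow> divisor_tuples k"
    by (force simp: divisor_tuples_def ratio_lists_def)
  show "(\<lambda>i\<in>{1..k}. map d [1..<Suc k] ! (i - 1)) = d" if "d \<in> divisor_tuples k" for d
    using that by (auto simp: divisor_tuples_def PiE_iff extensional_def fun_eq_iff simp del: upt_Suc)
  show "map (\<lambda>i\<in>{1..k}. ds ! (i - 1)) [1..<Suc k] = ds" if "ds \<in> ratio_lists k" for ds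
    using that by (intro nth_equalityI) (auto simp: ratio_lists_def simp del: upt_Suc)
qed

lemma layer_eq_tuple_sum:
  assumes "s > 1" "t > 0"
  shows "((\<lambda>d. 1 / real (t + product_sum k d) powr s) has_sum layer t s k) (divisor_tuples k)"
proof -
  have "((\<lambda>ds. real (t + nested_sum ds) powr -s) has_sum layer t s k) (ratio_lists k)"
    unfolding layer_def by (rule has_sum_infsum[OF layer_summable[OF assms]])
  then show ?thesis
    by (subst (asm) has_sum_reindex_bij_betw[OF bij_betw_divisor_tuples, symmetric])
       (simp add: product_sum_eq_nested_sum powr_minus_divide del: upt_Suc)
qed

section \<open>The Dirichlet series of chain partitions\<close>

text \<open>
  The parts in increasing order, built from the smallest part and the successive quotients; chain
  partitions list them in decreasing order, so this is their reversal.
\<close>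

fun multiples_chain :: "nat \<Rightarrow> nat list \<Rightarrow> nat list" where
  "multiples_chain m [] = [m]"
| "multiples_chain m (d # ds) = m # multiples_chain (m * d) ds"

lemma multiples_chain_hd: "multiples_chain m ds \<noteq> [] \<and> hd (multiples_chain m ds) = m"
  by (cases ds) auto

lemma sum_list_multiples_chain: "sum_list (multiples_chain m ds) = m * (1 + nested_sum ds)"
  by (induction ds arbitrary: m) (auto simp: algebra_simps)

lemma multiples_chain_inj:
  assumes "multiples_chain m ds = multiples_chain m' ds'" "m > 0" "ds \<in> lists {1<..}"
  shows "m = m' \<and> ds = ds'"
  using assms
proof (induction ds arbitrary: m m' ds')
  case Nil
  then show ?case using multiples_chain_hd by (cases ds') (auto, metis)
next
  case (Cons d ds)
  then obtain d' es where ds': "ds' = d' # es"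
    using multiples_chain_hd by (cases ds') auto
  with Cons show ?case by fastforce
qed

lemma multiples_chain_valid:
  assumes "m > 0" "ds \<in> lists {1<..}"
  shows "(\<forall>x\<in>set (multiples_chain m ds). 0 < x) \<and>
         successively (\<lambda>x y. x dvd y \<and> x \<noteq> y) (multiples_chain m ds)"
  using assms
proof (induction ds arbitrary: m)
  case (Cons d ds)
  then have "m * d > 0" "ds \<in> lists {1<..}" "d > 1"
    by auto
  then show ?case
    using Cons.IH[of "m * d"] multiples_chain_hd[of "m * d" ds] Cons.prems(1)
    by (simp add: successively_Cons)
qed simp

lemma multiples_chain_surj:
  assumes "xs \<noteq> []" "\<forall>x\<in>set xs. 0 < x" "successively (\<lambda>x y. x dvd y \<and> x \<noteq> y) xs"
  shows "\<exists>ds\<in>lists {1<..}. multiples_chain (hd xs) ds = xs"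
  using assms
proof (induction xs)
  case (Cons x xs)
  show ?case
  proof (cases "xs = []")
    case True
    then show ?thesis by (intro bexI[of _ "[]"]) auto
  next
    case False
    with Cons obtain ds where ds: "ds \<in> lists {1<..}" "multiples_chain (hd xs) ds = xs"
      by (auto simp: successively_Cons)
    from False Cons.prems have "x dvd hd xs" "x \<noteq> hd xs" "hd xs > 0"
      by (auto simp: successively_Cons)
    then obtain d where d: "hd xs = x * d" "d > 1"
      by (metis One_nat_def dvdE gr0I mult_0_right mult.right_neutral nat_neq_iff less_one)
    with ds show ?thesis by (intro bexI[of _ "d # ds"]) auto
  qed
qed simp

text \<open>
  The first component of the image records the number that is partitioned, so that all numbers are
  treated by one bijection and the Dirichlet series can afterwards be summed fibrewise.
\<close>

lemma bij_betw_chain_partitions: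
  "bij_betw (\<lambda>(m, ds). (m * (1 + nested_sum ds), rev (multiples_chain m ds)))
     ({0<..} \<times> lists {1<..}) (Sigma {0<..} chain_partitions)"
proof (rule bij_betw_imageI)
  show "inj_on (\<lambda>(m, ds). (m * (1 + nested_sum ds), rev (multiples_chain m ds))) ({0<..} \<times> lists {1<..})"
    using multiples_chain_inj by (auto simp: inj_on_def)
next
  have "(m * (1 + nested_sum ds), rev (multiples_chain m ds)) \<in> Sigma {0<..} chain_partitions"
    if "m > 0" "ds \<in> lists {1<..}" for m ds
    using multiples_chain_valid[OF that] multiples_chain_hd[of m ds] that
    by (auto simp: chain_partitions_def sum_list_multiples_chain successively_rev sum_list_rev conj_commute)
  moreover have "(n, xs) \<in> (\<lambda>(m, ds). (m * (1 + nested_sum ds), rev (multiples_chain m ds))) ` ({0<..} \<times> lists {1<..})"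
    if "xs \<in> chain_partitions n" for n xs
  proof -
    have "rev xs \<noteq> []" "\<forall>x\<in>set (rev xs). 0 < x" "successively (\<lambda>x y. x dvd y \<and> x \<noteq> y) (rev xs)"
      and n: "sum_list xs = n"
      using that by (auto simp: chain_partitions_def successively_rev)
    moreover from this obtain ds where ds: "ds \<in> lists {1<..}" "multiples_chain (hd (rev xs)) ds = rev xs"
      using multiples_chain_surj by blast
    ultimately have "hd (rev xs) > 0" "n = hd (rev xs) * (1 + nested_sum ds)"
      using sum_list_multiples_chain[of "hd (rev xs)" ds] hd_in_set[of "rev xs"]
      by (auto simp: sum_list_rev simp del: set_rev)
    with ds show ?thesis
      by (intro image_eqI[of _ _ "(hd (rev xs), ds)"]) auto
  qed
  ultimately show "(\<lambda>(m, ds). (m * (1 + nested_sum ds), rev (multiples_chain m ds))) ` ({0<..} \<times> lists {1<..})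
      = Sigma {0<..} chain_partitions"
    by (intro equalityI subsetI) auto
qed

text \<open>
  Needed because the cardinality of an infinite set would be 0 by convention.
\<close>

lemma finite_chain_partitions: "finite (chain_partitions n)"
proof (rule finite_subset)
  show "chain_partitions n \<subseteq> {xs. set xs \<subseteq> {..n} \<and> length xs \<le> n}"
  proof safe
    fix xs x assume xs: "xs \<in> chain_partitions n"
    then show "x \<le> n" if "x \<in> set xs"
      using member_le_sum_list[OF that] by (auto simp: chain_partitions_def)
    have "length xs = sum_list (map (\<lambda>_. 1) xs)"
      by (simp add: sum_list_triv)
    also have "\<dots> \<le> sum_list (map (\<lambda>x. x) xs)"
      using xs by (intro sum_list_mono) (auto simp: chain_partitions_def Suc_le_eq)
    finally show "length xs \<le> n"
      using xs by (simp add: chain_partitions_def)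
  qed
qed (rule finite_lists_length_le, simp)

text \<open>
  The factor \<open>\<zeta>(s)\<close> comes from the smallest part and the sum of the layers from the quotients.
\<close>

lemma chain_partition_series:
  assumes "s > 1" "zeta s < 2"
  shows "(\<lambda>n. real (chain_partition_count (Suc n)) * real (Suc n) powr -s)
           sums (zeta s * (\<Sum>k. layer 1 s k))"
proof -
  have "((\<lambda>(m, ds). real m powr -s * real (1 + nested_sum ds) powr -s)
          has_sum zeta s * (\<Sum>k. layer 1 s k)) ({0<..} \<times> lists {1<..})"
    by (rule has_sum_times_nonneg[OF zeta_has_sum layers_has_sum]) (use assms in auto)
  then have "((\<lambda>x. (\<lambda>(n, xs). real n powr -s) (case x of (m, ds) \<Rightarrow>
               (m * (1 + nested_sum ds), rev (multiples_chain m ds))))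
          has_sum zeta s * (\<Sum>k. layer 1 s k)) ({0<..} \<times> lists {1<..})"
    by (rule has_sum_cong[THEN iffD1, rotated])
       (simp only: case_prod_unfold fst_conv snd_conv of_nat_mult powr_mult of_nat_0_le_iff)
  then have "((\<lambda>(n, xs). real n powr -s) has_sum zeta s * (\<Sum>k. layer 1 s k)) (Sigma {0<..} chain_partitions)"
    by (subst (asm) has_sum_reindex_bij_betw[OF bij_betw_chain_partitions])
  then have "((\<lambda>n. real (chain_partition_count n) * real n powr -s)
                has_sum zeta s * (\<Sum>k. layer 1 s k)) {0<..}"
    by (rule has_sum_SigmaD) (auto intro!: has_sum_finiteI simp: finite_chain_partitions chain_partition_count_def)
  moreover have "bij_betw Suc UNIV {0<..}"
    by (rule bij_betwI[where g = "\<lambda>n. n - 1"]) auto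
  ultimately show ?thesis
    using has_sum_reindex_bij_betw[of Suc UNIV "{0<..}" "\<lambda>n. real (chain_partition_count n) * real n powr -s"]
    by (intro has_sum_imp_sums) blast
qed

section \<open>An Abelian theorem for Dirichlet series\<close>

text \<open>
  Both bounds come from
  \<open>v = s \<integral> t\<^sup>\<rho> t\<^sup>-\<^sup>s\<^sup>-\<^sup>1 dt\<close> over \<open>{x..x + 1}\<close>, since \<open>t\<^sup>\<rho>\<close> lies between \<open>x\<^sup>\<rho>\<close> and \<open>(x + 1)\<^sup>\<rho>\<close>. The proof replaces
  the integral by the monotonicity of the antiderivatives. The point of \<open>v\<close> is that its sum over
  \<open>x = 1, 2, \<dots>\<close> telescopes to exactly \<open>s / (s - \<rho>)\<close>.
\<close>

lemma powr_telescoping_comparison: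
  fixes \<rho> s x :: real
  assumes "0 < \<rho>" "\<rho> < s" "0 < x"
  defines "v \<equiv> s / (s - \<rho>) * (x powr (\<rho> - s) - (x + 1) powr (\<rho> - s))"
  shows "x powr \<rho> * (x powr -s - (x + 1) powr -s) \<le> v"
    and "v \<le> (x + 1) powr \<rho> * (x powr -s - (x + 1) powr -s)"
proof -
  \<comment> \<open>With \<open>b = x\<close> this derivative is nonpositive on the interval, with \<open>b = x + 1\<close> nonnegative.\<close>
  have deriv: "((\<lambda>t. s / (s - \<rho>) * t powr (\<rho> - s) - b powr \<rho> * t powr -s)
      has_real_derivative s * t powr (-s - 1) * (b powr \<rho> - t powr \<rho>)) (at t)"
    if "t > 0" for t b
  proof -
    have "s / (s - \<rho>) * (\<rho> - s) = - s"
      using assms(2) by (simp add: divide_simps) (simp add: algebra_simps)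
    moreover have "t powr (\<rho> - s - 1) = t powr (-s - 1) * t powr \<rho>"
      by (simp add: algebra_simps flip: powr_add)
    ultimately have eq: "s / (s - \<rho>) * ((\<rho> - s) * t powr (\<rho> - s - 1)) = - s * t powr (-s - 1) * t powr \<rho>"
      by (metis mult.assoc)
    have "((\<lambda>t. s / (s - \<rho>) * t powr (\<rho> - s) - b powr \<rho> * t powr -s) has_real_derivative
            s / (s - \<rho>) * ((\<rho> - s) * t powr (\<rho> - s - 1)) - b powr \<rho> * (-s * t powr (-s - 1))) (at t)"
      by (intro DERIV_diff DERIV_cmult has_real_derivative_powr that)
    then show ?thesis
      unfolding eq by (simp add: algebra_simps)
  qed
  have "s / (s - \<rho>) * (x + 1) powr (\<rho> - s) - x powr \<rho> * (x + 1) powr -s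
          \<le> s / (s - \<rho>) * x powr (\<rho> - s) - x powr \<rho> * x powr -s"
  proof (rule DERIV_nonpos_imp_nonincreasing[of x "x + 1"])
    fix t assume t: "x \<le> t" "t \<le> x + 1"
    then have "s * t powr (-s - 1) * (x powr \<rho> - t powr \<rho>) \<le> 0"
      using assms by (intro mult_nonneg_nonpos) (auto intro!: powr_mono2)
    moreover have "t > 0" using t assms(3) by simp
    ultimately show "\<exists>y. ((\<lambda>t. s / (s - \<rho>) * t powr (\<rho> - s) - x powr \<rho> * t powr -s)
        has_real_derivative y) (at t) \<and> y \<le> 0"
      using deriv by blast
  qed simp
  then show "x powr \<rho> * (x powr -s - (x + 1) powr -s) \<le> v"
    by (simp add: v_def algebra_simps)
  have "s / (s - \<rho>) * x powr (\<rho> - s) - (x + 1) powr \<rho> * x powr -s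
          \<le> s / (s - \<rho>) * (x + 1) powr (\<rho> - s) - (x + 1) powr \<rho> * (x + 1) powr -s"
  proof (rule DERIV_nonneg_imp_nondecreasing[of x "x + 1"])
    fix t assume t: "x \<le> t" "t \<le> x + 1"
    then have "s * t powr (-s - 1) * ((x + 1) powr \<rho> - t powr \<rho>) \<ge> 0"
      using assms by (intro mult_nonneg_nonneg) (auto intro!: powr_mono2)
    moreover have "t > 0" using t assms(3) by simp
    ultimately show "\<exists>y. ((\<lambda>t. s / (s - \<rho>) * t powr (\<rho> - s) - (x + 1) powr \<rho> * t powr -s)
        has_real_derivative y) (at t) \<and> y \<ge> 0"
      using deriv by blast
  qed simp
  then show "v \<le> (x + 1) powr \<rho> * (x powr -s - (x + 1) powr -s)"
    by (simp add: v_def algebra_simps)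
qed

text \<open>
  Summation by parts writes \<open>D s\<close> as the sum of \<open>B n * u s n\<close>, where \<open>B\<close> are the partial sums of \<open>b\<close>. As
  \<open>B n\<close> is close to \<open>c (n + 1)\<^sup>\<rho>\<close>, these terms differ from \<open>c * v s n\<close> by at most \<open>e n * v s n\<close>, where \<open>e n\<close>
  tends to 0 and does not depend on \<open>s\<close>. The main terms sum to \<open>c s / (s - \<rho>)\<close>; of the error, finitely many
  terms stay bounded as \<open>s\<close> tends to \<open>\<rho>\<close>, and the rest is at most \<open>\<epsilon> s / (s - \<rho>)\<close>.
\<close>

lemma dirichlet_series_pole:
  fixes b :: "nat \<Rightarrow> real" and D :: "real \<Rightarrow> real" and \<rho> c :: real
  assumes \<rho>: "\<rho> > 0"
    and B: "(\<lambda>n. (\<Sum>i\<le>n. b i) / real (Suc n) powr \<rho>) \<longlonglongrightarrow> c"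
    and D: "eventually (\<lambda>s. (\<lambda>i. b i * real (Suc i) powr -s) sums D s) (at_right \<rho>)"
  shows "((\<lambda>s. (s - \<rho>) * D s) \<longlongrightarrow> \<rho> * c) (at_right \<rho>)"
proof -
  define B where "B n = (\<Sum>i\<le>n. b i)" for n
  define u where "u s n = real (Suc n) powr -s - real (Suc (Suc n)) powr -s" for s n
  define v where "v s n = s / (s - \<rho>) * (real (Suc n) powr (\<rho> - s) - real (Suc (Suc n)) powr (\<rho> - s))" for s n
  define e where "e n = \<bar>B n / real (Suc n) powr \<rho> - c\<bar>
      + \<bar>c\<bar> * (1 - (real (Suc n) / real (Suc (Suc n))) powr \<rho>)" for n
  have Suc_tendsto: "(\<lambda>n. real (Suc n) powr (- d)) \<longlonglongrightarrow> 0" if "d > 0" for d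
    using that by (intro tendsto_neg_powr filterlim_compose[OF filterlim_real_sequentially filterlim_Suc]) auto
  have e_nonneg: "e n \<ge> 0" for n
    using \<rho> by (auto simp: e_def intro!: add_nonneg_nonneg mult_nonneg_nonneg powr_le1)
  have "(\<lambda>n. real (Suc n) / real (Suc (Suc n))) \<longlonglongrightarrow> 1"
    using LIMSEQ_n_over_Suc_n[THEN LIMSEQ_Suc] by simp
  then have "e \<longlonglongrightarrow> \<bar>c - c\<bar> + \<bar>c\<bar> * (1 - 1 powr \<rho>)"
    unfolding e_def B_def by (intro tendsto_intros B) auto
  then have e_tendsto: "e \<longlonglongrightarrow> 0" by simp
  have u_nonneg: "u s n \<ge> 0" if "s > \<rho>" for s n
    using that \<rho> by (simp add: u_def powr_mono2')
  have v_bounds: "real (Suc n) powr \<rho> * u s n \<le> v s n" "v s n \<le> real (Suc (Suc n)) powr \<rho> * u s n"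
    if "s > \<rho>" for s n
    using powr_telescoping_comparison[of \<rho> s "real (Suc n)"] that \<rho> by (simp_all add: u_def v_def add.commute)
  have v_nonneg: "v s n \<ge> 0" if "s > \<rho>" for s n
    using v_bounds(1)[OF that, of n] u_nonneg[OF that, of n] by (meson order_trans mult_nonneg_nonneg powr_ge_zero)
  have v_sums: "v s sums (s / (s - \<rho>))" if "s > \<rho>" for s
  proof -
    have "(\<lambda>n. real (Suc n) powr (\<rho> - s)) \<longlonglongrightarrow> 0"
      using Suc_tendsto[of "s - \<rho>"] that by simp
    from sums_mult[OF telescope_sums'[OF this], of "s / (s - \<rho>)"] show ?thesis
      by (simp add: v_def[abs_def] algebra_simps)
  qed
  have close: "\<bar>B n * u s n - c * v s n\<bar> \<le> e n * v s n" if "s > \<rho>" for s n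
  proof -
    \<comment> \<open>Two replacements: \<open>B n\<close> by \<open>c (n + 1)\<^sup>\<rho>\<close>, which costs the first summand of \<open>e n\<close>, and then \<open>x\<close> by \<open>v s n\<close>, the second.\<close>
    define x where "x = real (Suc n) powr \<rho> * u s n"
    have pos: "real (Suc n) powr \<rho> > 0" "real (Suc (Suc n)) powr \<rho> > 0" by auto
    have x: "0 \<le> x" "x \<le> v s n"
      using v_bounds(1)[OF that] u_nonneg[OF that] by (auto simp: x_def)
    have "(real (Suc n) / real (Suc (Suc n))) powr \<rho> * v s n
            \<le> (real (Suc n) / real (Suc (Suc n))) powr \<rho> * (real (Suc (Suc n)) powr \<rho> * u s n)"
      by (intro mult_left_mono v_bounds(2) that) auto
    also have "\<dots> = x"
      using pos by (simp add: x_def powr_divide del: of_nat_Suc)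
    finally have "\<bar>x - v s n\<bar> \<le> (1 - (real (Suc n) / real (Suc (Suc n))) powr \<rho>) * v s n"
      using x by (simp add: algebra_simps)
    then have "\<bar>c\<bar> * \<bar>x - v s n\<bar> \<le> \<bar>c\<bar> * ((1 - (real (Suc n) / real (Suc (Suc n))) powr \<rho>) * v s n)"
      by (rule mult_left_mono) simp
    moreover have "\<bar>B n / real (Suc n) powr \<rho> - c\<bar> * x \<le> \<bar>B n / real (Suc n) powr \<rho> - c\<bar> * v s n"
      using x by (intro mult_left_mono) auto
    moreover have "B n * u s n - c * v s n = (B n / real (Suc n) powr \<rho> - c) * x + c * (x - v s n)"
      using pos by (simp add: x_def field_simps del: of_nat_Suc)
    then have "\<bar>B n * u s n - c * v s n\<bar> \<le> \<bar>B n / real (Suc n) powr \<rho> - c\<bar> * x + \<bar>c\<bar> * \<bar>x - v s n\<bar>"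
      using abs_triangle_ineq[of "(B n / real (Suc n) powr \<rho> - c) * x" "c * (x - v s n)"] x by (simp add: abs_mult)
    ultimately show ?thesis
      by (simp add: e_def algebra_simps)
  qed
  have abel: "(\<lambda>n. B n * u s n) sums D s"
    if s: "s > \<rho>" and D: "(\<lambda>i. b i * real (Suc i) powr -s) sums D s" for s
  proof -
    have partial: "(\<Sum>n\<le>N. B n * u s n) = (\<Sum>i\<le>N. b i * real (Suc i) powr -s) - B N * real (Suc (Suc N)) powr -s" for N
      by (induction N) (simp_all add: u_def B_def algebra_simps)
    have "(\<lambda>N. B N / real (Suc N) powr \<rho> * (real (Suc N) / real (Suc (Suc N))) powr \<rho>
              * real (Suc (Suc N)) powr -(s - \<rho>)) \<longlonglongrightarrow> c * 1 powr \<rho> * 0"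
      unfolding B_def using s \<open>(\<lambda>n. real (Suc n) / real (Suc (Suc n))) \<longlonglongrightarrow> 1\<close>
      by (intro tendsto_mult tendsto_powr B tendsto_const LIMSEQ_Suc[OF Suc_tendsto]) auto
    also have "(\<lambda>N. B N / real (Suc N) powr \<rho> * (real (Suc N) / real (Suc (Suc N))) powr \<rho>
              * real (Suc (Suc N)) powr -(s - \<rho>)) = (\<lambda>N. B N * real (Suc (Suc N)) powr -s)"
      by (auto simp: powr_divide powr_diff powr_minus field_simps simp del: of_nat_Suc)
    finally have "(\<lambda>N. B N * real (Suc (Suc N)) powr -s) \<longlonglongrightarrow> 0" by simp
    with D have "(\<lambda>N. \<Sum>n\<le>N. B n * u s n) \<longlonglongrightarrow> D s - 0"
      unfolding partial sums_def_le by (intro tendsto_diff)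
    then show ?thesis by (simp add: sums_def_le)
  qed
  have "((\<lambda>s. (s - \<rho>) * D s - s * c) \<longlongrightarrow> 0) (at_right \<rho>)"
  proof (rule tendstoI)
    fix r :: real assume r: "r > 0"
    \<comment> \<open>The error bound below tends to \<open>\<epsilon> * \<rho>\<close>, which is then half of \<open>r\<close>.\<close>
    define \<epsilon> where "\<epsilon> = r / (2 * \<rho>)"
    have "\<epsilon> > 0" using r \<rho> by (simp add: \<epsilon>_def)
    then obtain N where N: "\<And>n. n \<ge> N \<Longrightarrow> e n < \<epsilon>"
      using order_tendstoD(2)[OF e_tendsto] by (auto simp: eventually_sequentially)
    define K where "K = (\<Sum>n<N. e n * real (Suc (Suc n)) powr \<rho>)"
    have bound: "\<bar>(s - \<rho>) * D s - s * c\<bar> \<le> (s - \<rho>) * K + \<epsilon> * s"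
      if s: "s > \<rho>" and D: "(\<lambda>i. b i * real (Suc i) powr -s) sums D s" for s
    proof -
      \<comment> \<open>A summable majorant of the errors: crude for the first \<open>N\<close> terms, and \<open>\<epsilon> * v s n\<close> throughout.\<close>
      define w where "w n = (if n < N then e n * real (Suc (Suc n)) powr \<rho> else 0) + \<epsilon> * v s n" for n
      have w: "w sums (K + \<epsilon> * (s / (s - \<rho>)))"
        unfolding w_def K_def
        by (intro sums_add sums_mult v_sums[OF s])
           (use sums_If_finite_set[of "{..<N}" "\<lambda>n. e n * real (Suc (Suc n)) powr \<rho>"] in
             \<open>simp_all del: of_nat_Suc\<close>)
      have le: "\<bar>B n * u s n - c * v s n\<bar> \<le> w n" for n
      proof (cases "n < N")
        case True
        have "u s n \<le> 1"
          using s \<rho> powr_mono2'[of "-s" 1 "real (Suc n)"] powr_ge_zero[of "real (Suc (Suc n))" "-s"]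
          by (simp add: u_def del: powr_ge_zero)
        then have "real (Suc (Suc n)) powr \<rho> * u s n \<le> real (Suc (Suc n)) powr \<rho> * 1"
          by (intro mult_left_mono) auto
        then have "e n * v s n \<le> e n * real (Suc (Suc n)) powr \<rho>"
          using order_trans[OF v_bounds(2)[OF s, of n]] e_nonneg[of n] by (intro mult_left_mono) auto
        then show ?thesis
          using True close[OF s, of n] v_nonneg[OF s, of n] \<open>\<epsilon> > 0\<close>
          by (simp add: w_def add_increasing2 del: of_nat_Suc)
      next
        case False
        then have "e n * v s n \<le> \<epsilon> * v s n"
          using N[of n] v_nonneg[OF s, of n] by (intro mult_right_mono) auto
        with False close[OF s, of n] show ?thesis by (simp add: w_def)
      qed
      have diff: "(\<lambda>n. B n * u s n - c * v s n) sums (D s - c * (s / (s - \<rho>)))"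
        by (intro sums_diff sums_mult v_sums abel s D)
      have "D s - c * (s / (s - \<rho>)) \<le> K + \<epsilon> * (s / (s - \<rho>))"
        by (rule sums_le[OF _ diff w]) (use le abs_le_D1 in blast)
      moreover have "- (D s - c * (s / (s - \<rho>))) \<le> K + \<epsilon> * (s / (s - \<rho>))"
        by (rule sums_le[OF _ sums_minus[OF diff] w]) (use le abs_le_D2 in blast)
      ultimately have "\<bar>D s - c * (s / (s - \<rho>))\<bar> \<le> K + \<epsilon> * (s / (s - \<rho>))"
        by linarith
      then have "(s - \<rho>) * \<bar>D s - c * (s / (s - \<rho>))\<bar> \<le> (s - \<rho>) * (K + \<epsilon> * (s / (s - \<rho>)))"
        using s by (intro mult_left_mono) auto
      moreover have "(s - \<rho>) * \<bar>D s - c * (s / (s - \<rho>))\<bar> = \<bar>(s - \<rho>) * (D s - c * (s / (s - \<rho>)))\<bar>"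
        using s by (simp add: abs_mult)
      moreover have "(s - \<rho>) * (D s - c * (s / (s - \<rho>))) = (s - \<rho>) * D s - s * c"
        "(s - \<rho>) * (K + \<epsilon> * (s / (s - \<rho>))) = (s - \<rho>) * K + \<epsilon> * s"
        using s by (auto simp: field_simps)
      ultimately show ?thesis by simp
    qed
    have "((\<lambda>s. (s - \<rho>) * K + \<epsilon> * s) \<longlongrightarrow> (\<rho> - \<rho>) * K + \<epsilon> * \<rho>) (at_right \<rho>)"
      by (intro tendsto_intros)
    moreover have "(\<rho> - \<rho>) * K + \<epsilon> * \<rho> < r"
      using r \<rho> by (simp add: \<epsilon>_def)
    ultimately have "eventually (\<lambda>s. (s - \<rho>) * K + \<epsilon> * s < r) (at_right \<rho>)"
      by (rule order_tendstoD)
    with D eventually_at_right_less[of \<rho>] show "eventually (\<lambda>s. dist ((s - \<rho>) * D s - s * c) 0 < r) (at_right \<rho>)"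
    proof eventually_elim
      case (elim s)
      with bound[of s] show ?case by simp
    qed
  qed
  then have "((\<lambda>s. ((s - \<rho>) * D s - s * c) + s * c) \<longlongrightarrow> 0 + \<rho> * c) (at_right \<rho>)"
    by (intro tendsto_intros)
  then show ?thesis by simp
qed

section \<open>The limit at the singularity\<close>

lemma chain_partition_sum_tendsto:
  assumes "c \<noteq> 0" "chain_partition_sum \<sim>[at_top] (\<lambda>x. c * x powr \<rho>)"
  shows "(\<lambda>n. (\<Sum>i\<le>n. real (chain_partition_count (Suc i))) / real (Suc n) powr \<rho>) \<longlonglongrightarrow> c"
proof -
  have partial: "chain_partition_sum (real (Suc n)) = (\<Sum>i\<le>n. real (chain_partition_count (Suc i)))" for n
  proof -
    have "{m. 1 \<le> m \<and> real m \<le> real (Suc n)} = Suc ` {..n}"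
      by (auto simp: image_Suc_atMost simp del: of_nat_Suc)
    then show ?thesis
      by (simp add: chain_partition_sum_def sum.reindex del: of_nat_Suc)
  qed
  have "eventually (\<lambda>x. chain_partition_sum x \<noteq> 0 \<or> c * x powr \<rho> \<noteq> 0) at_top"
    using eventually_gt_at_top[of 0] by eventually_elim (use assms(1) in auto)
  from asymp_equivD_strong[OF assms(2) this]
  have "((\<lambda>x. c * (chain_partition_sum x / (c * x powr \<rho>))) \<longlongrightarrow> c * 1) at_top"
    by (intro tendsto_mult tendsto_const)
  then have "((\<lambda>x. chain_partition_sum x / x powr \<rho>) \<longlongrightarrow> c) at_top"
    using assms(1) by simp
  from filterlim_compose[OF this filterlim_compose[OF filterlim_real_sequentially filterlim_Suc]]
  show ?thesis by (simp only: partial)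
qed

text \<open>
  The simple zero of \<open>2 - \<zeta>(s)\<close> at \<open>\<rho>\<close> cancels the pole of the Dirichlet series \<open>\<zeta>(s) (\<Sum>k. F\<^sub>k(s))\<close>,
  whose residue is \<open>\<rho> c\<close>; the division by \<open>\<zeta>(\<rho>) = 2\<close> removes the factor \<open>\<zeta>\<close>.
\<close>

lemma layers_limit:
  assumes \<rho>: "\<rho> > 1" "zeta \<rho> = 2"
    and c: "c \<noteq> 0" "chain_partition_sum \<sim>[at_top] (\<lambda>x. c * x powr \<rho>)"
    and D: "(zeta has_real_derivative D) (at \<rho>)" "D < 0"
  shows "eventually (\<lambda>s. s > \<rho> \<and> zeta s < 2) (at_right \<rho>)"
    and "((\<lambda>s. (2 - zeta s) * (\<Sum>k. layer 1 s k)) \<longlongrightarrow> - D * \<rho> * c / 2) (at_right \<rho>)"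
proof -
  obtain d where d: "d > 0" "\<And>h. h > 0 \<Longrightarrow> \<rho> + h \<in> UNIV \<Longrightarrow> h < d \<Longrightarrow> zeta (\<rho> + h) < zeta \<rho>"
    using has_real_derivative_neg_dec_right[OF D] by blast
  have "s > \<rho> \<and> zeta s < 2" if "\<rho> < s" "s < \<rho> + d" for s
    using d(2)[of "s - \<rho>"] that \<rho> by simp
  then show ev: "eventually (\<lambda>s. s > \<rho> \<and> zeta s < 2) (at_right \<rho>)"
    using d(1) by (intro eventually_at_rightI[of \<rho> "\<rho> + d"]) auto
  have pole: "((\<lambda>s. (s - \<rho>) * (zeta s * (\<Sum>k. layer 1 s k))) \<longlongrightarrow> \<rho> * c) (at_right \<rho>)"
  proof (rule dirichlet_series_pole)
    show "eventually (\<lambda>s. (\<lambda>i. real (chain_partition_count (Suc i)) * real (Suc i) powr -s)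
            sums (zeta s * (\<Sum>k. layer 1 s k))) (at_right \<rho>)"
      using ev by eventually_elim (use \<rho> in \<open>intro chain_partition_series, auto\<close>)
  qed (use \<rho> chain_partition_sum_tendsto[OF c] in auto)
  have "(zeta \<longlongrightarrow> 2) (at_right \<rho>)"
    using DERIV_isCont[OF D(1)] \<rho>(2) by (auto simp: isCont_def intro: filterlim_mono[OF _ order_refl at_le])
  moreover have "((\<lambda>s. - ((zeta s - zeta \<rho>) / (s - \<rho>))) \<longlongrightarrow> - D) (at_right \<rho>)"
    using D(1) unfolding has_field_derivative_iff
    by (intro tendsto_minus) (auto intro: filterlim_mono[OF _ order_refl at_le])
  ultimately have "((\<lambda>s. - ((zeta s - zeta \<rho>) / (s - \<rho>)) * ((s - \<rho>) * (zeta s * (\<Sum>k. layer 1 s k))) / zeta s)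
      \<longlongrightarrow> - D * (\<rho> * c) / 2) (at_right \<rho>)"
    by (intro tendsto_divide tendsto_mult pole) auto
  moreover have "eventually (\<lambda>s. - ((zeta s - zeta \<rho>) / (s - \<rho>)) * ((s - \<rho>) * (zeta s * (\<Sum>k. layer 1 s k))) / zeta s
      = (2 - zeta s) * (\<Sum>k. layer 1 s k)) (at_right \<rho>)"
    using ev
  proof eventually_elim
    case (elim s)
    then have "s - \<rho> \<noteq> 0" "zeta s \<noteq> 0"
      using \<rho> zeta_ge_1[of s] by auto
    then show ?case by (simp add: \<rho>) (simp add: algebra_simps)
  qed
  ultimately have "((\<lambda>s. (2 - zeta s) * (\<Sum>k. layer 1 s k)) \<longlongrightarrow> - D * (\<rho> * c) / 2) (at_right \<rho>)"
    by (rule Lim_transform_eventually)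
  then show "((\<lambda>s. (2 - zeta s) * (\<Sum>k. layer 1 s k)) \<longlongrightarrow> - D * \<rho> * c / 2) (at_right \<rho>)"
    by (simp add: mult.assoc)
qed

theorem theorem3:
  fixes \<rho> c :: real and k :: nat
  assumes rho: "\<rho> > 1" "zeta \<rho> = 2"
    and c: "c > 0" "chain_partition_sum \<sim>[at_top] (\<lambda>x. c * x powr \<rho>)"
    and k: "k \<ge> 1"
  shows "(\<lambda>d. 1 / real (2 + product_sum k d) powr \<rho>) summable_on divisor_tuples k
       \<and> (\<lambda>d. 1 / real (1 + product_sum k d) powr \<rho>) summable_on divisor_tuples k
       \<and> - (2 / (\<rho> * deriv zeta \<rho>)) *
           (\<Sum>\<^sub>\<infinity>d\<in>divisor_tuples k. 1 / real (2 + product_sum k d) powr \<rho>) \<le> c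
       \<and> c \<le> - (2 / (\<rho> * deriv zeta \<rho>)) *
           (\<Sum>\<^sub>\<infinity>d\<in>divisor_tuples k. 1 / real (1 + product_sum k d) powr \<rho>)"
proof -
  obtain D where D: "(zeta has_real_derivative D) (at \<rho>)" "D < 0"
    using zeta_has_negative_derivative[OF rho(1)] .
  have c0: "c \<noteq> 0" using c(1) by simp
  note ev = layers_limit(1)[OF rho c0 c(2) D] and lim = layers_limit(2)[OF rho c0 c(2) D]
  have nontrivial: "at_right \<rho> \<noteq> bot" by simp
  \<comment> \<open>For the upper bound all layers are replaced by their values at \<open>\<rho>\<close>, which are larger; continuity of the layers is thus avoided.\<close>
  have "- D * \<rho> * c / 2 \<le> layer 1 \<rho> k"
  proof (rule tendsto_le[OF nontrivial _ lim])
    have "isCont zeta \<rho>"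
      using DERIV_isCont[OF D(1)] .
    then have "(zeta \<longlongrightarrow> zeta \<rho>) (at_right \<rho>)"
      by (auto simp: isCont_def intro: filterlim_mono[OF _ order_refl at_le])
    then have "((\<lambda>s. (2 - zeta s) * (\<Sum>j<k. layer 1 \<rho> j) + layer 1 \<rho> k) \<longlongrightarrow>
        (2 - zeta \<rho>) * (\<Sum>j<k. layer 1 \<rho> j) + layer 1 \<rho> k) (at_right \<rho>)"
      by (intro tendsto_intros)
    then show "((\<lambda>s. (2 - zeta s) * (\<Sum>j<k. layer 1 \<rho> j) + layer 1 \<rho> k) \<longlongrightarrow> layer 1 \<rho> k) (at_right \<rho>)"
      by (simp add: rho)
    show "eventually (\<lambda>s. (2 - zeta s) * (\<Sum>j. layer 1 s j)
            \<le> (2 - zeta s) * (\<Sum>j<k. layer 1 \<rho> j) + layer 1 \<rho> k) (at_right \<rho>)"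
      using ev
    proof eventually_elim
      case (elim s)
      then have s: "s > 1" "zeta s < 2" using rho by auto
      have "(2 - zeta s) * (\<Sum>j<k. layer 1 s j) \<le> (2 - zeta s) * (\<Sum>j<k. layer 1 \<rho> j)"
        using s elim rho by (intro mult_left_mono sum_mono layer_1_antimono) auto
      moreover have "layer 1 s k \<le> layer 1 \<rho> k"
        using elim rho by (intro layer_1_antimono) auto
      ultimately show ?case using layers_upper[OF s, of k] by linarith
    qed
  qed
  \<comment> \<open>For the lower bound the limit is taken in finite partial sums, which are continuous in \<open>s\<close>.\<close>
  moreover have "layer 2 \<rho> k \<le> - D * \<rho> * c / 2"
    unfolding layer_def
  proof (rule infsum_le_finite_sums)
    fix F assume F: "finite F" "F \<subseteq> ratio_lists k"
    show "(\<Sum>ds\<in>F. real (2 + nested_sum ds) powr -\<rho>) \<le> - D * \<rho> * c / 2"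
    proof (rule tendsto_le[OF nontrivial lim])
      show "((\<lambda>s. \<Sum>ds\<in>F. real (2 + nested_sum ds) powr -s) \<longlongrightarrow>
          (\<Sum>ds\<in>F. real (2 + nested_sum ds) powr -\<rho>)) (at_right \<rho>)"
        by (intro tendsto_intros) auto
      show "eventually (\<lambda>s. (\<Sum>ds\<in>F. real (2 + nested_sum ds) powr -s)
              \<le> (2 - zeta s) * (\<Sum>j. layer 1 s j)) (at_right \<rho>)"
        using ev
      proof eventually_elim
        case (elim s)
        then have s: "s > 1" "zeta s < 2" using rho by auto
        have "(\<Sum>ds\<in>F. real (2 + nested_sum ds) powr -s) \<le> layer 2 s k"
          unfolding layer_def using F by (intro finite_sum_le_infsum layer_summable s) auto
        with layers_lower[OF s, of k] show ?case by linarith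
      qed
    qed
  qed (rule layer_summable, use rho in auto)
  moreover have "deriv zeta \<rho> = D"
    using D(1) by (rule DERIV_imp_deriv)
  moreover have "- (2 / (\<rho> * D)) * x \<le> c \<longleftrightarrow> x \<le> - D * \<rho> * c / 2"
    "c \<le> - (2 / (\<rho> * D)) * x \<longleftrightarrow> - D * \<rho> * c / 2 \<le> x" for x
    using mult_pos_neg[of \<rho> D] D(2) rho(1) by (auto simp: divide_simps algebra_simps)
  ultimately show ?thesis
    using layer_eq_tuple_sum[OF rho(1), of 1 k] layer_eq_tuple_sum[OF rho(1), of 2 k]
    by (auto simp: has_sum_iff)
qed

end
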